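(* For $i=1,2$ let $\mathcal L_i=\langle C_i,\models_{M_i}\rangle$ be non-trivial matrix logics, where $M_i=(\mathbf A_i,D_i)$ is a $C_i$-matrix with universe $A_i$, and let $(\lambda,\mu)$ be a fibring pair, i.e. $\lambda:A_1\to A_2$ and $\mu:A_2\to A_1$. Then $[\mathcal L_1\circledast\mathcal L_2]_{(\lambda,\mu)}$ is a weak conservative extension of both $\mathcal L_1$ and $\mathcal L_2$: for each $i\in\{1,2\}$ and each $\varphi\in L(C_i)$, $\models_{M_i}\varphi$ if and only if $\models_{(M_1\circledast M_2)_{(\lambda,\mu)}}\varphi$.
   Context: Fix a countable set $\mathcal V=\{p_1,p_2,\dots\}$ of propositional variables. A signature $C=\{C^k\}_{k\in\mathbb N}$ is a family of pairwise disjoint sets, disjoint from $\mathcal V$ ($C^k$ is the set of $k$-ary connectives); $L(C)$ is the absolutely free algebra over $C$ generated by $\mathcal V$. A $C$-matrix is $M=(\mathbf A,D)$ with $\mathbf A$ a $C$-algebra with universe $A$ and $D\subseteq A$. An $M$-valuation is a homomorphism $v:L(C)\to\mathbf A$. $\Gamma\models_M\varphi$ means: for every $M$-valuation $v$, $v(\Gamma)\subseteq D$ implies $v(\varphi)\in D$; $\models_M\varphi$ means $\emptyset\models_M\varphi$. A matrix logic here is a pair $\langle C,\models_M\rangle$. A logic $\langle C,\vdash\rangle$ is trivial if $\Gamma\vdash\varphi$ for every $\Gamma\cup\{\varphi\}\subseteq L(C)$, and non-trivial otherwise. Put $C_\circledast=C_1\uplus C_2$, $A_\circledast=A_1\uplus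 A_2$, $D_\circledast=D_1\uplus D_2$ (disjoint unions; $L(C_i)$ is regarded as a subset of $L(C_\circledast)$). Define $\ast_\lambda:A_\circledast\to A_2$ by $\ast_\lambda(x)=\lambda(x)$ if $x\in A_1$, $\ast_\lambda(x)=x$ if $x\in A_2$; and $\ast_\mu:A_\circledast\to A_1$ by $\ast_\mu(x)=x$ if $x\in A_1$, $\ast_\mu(x)=\mu(x)$ if $x\in A_2$. The fibred $C_\circledast$-matrix $(M_1\circledast M_2)_{(\lambda,\mu)}$ has universe $A_\circledast$, designated set $D_\circledast$, and operations $c(x_1,\dots,x_k)=c^{\mathbf A_1}(\ast_\mu(x_1),\dots,\ast_\mu(x_k))$ for $c\in C_1^k$ and $c(x_1,\dots,x_k)=c^{\mathbf A_2}(\ast_\lambda(x_1),\dots,\ast_\lambda(x_k))$ for $c\in C_2^k$. The fibring by functions is $[\mathcal L_1\circledast\mathcal L_2]_{(\lambda,\mu)}=\langle C_\circledast,\models_{(M_1\circledast M_2)_{(\lambda,\mu)}}\rangle$. *)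

theory Defs
  imports Main "HOL-Library.FuncSet" "HOL-Library.Disjoint_Sets"
begin

text \<open>A signature is a family \<open>C\<close> of sets, \<open>C k\<close> being the set of \<open>k\<close>-ary connectives.
  Connectives are disjoint from the variables \<open>p\<^sub>0, p\<^sub>1, \<dots>\<close> because the two enter formulas
  through different constructors.\<close>

type_synonym 'c signature = "nat \<Rightarrow> 'c set"

definition is_signature :: "'c signature \<Rightarrow> bool" where
  "is_signature C \<longleftrightarrow> disjoint_family C"

datatype 'c fm = Var nat | App 'c "'c fm list"

text \<open>The universe of the absolutely free algebra \<open>L(C)\<close>; elements of \<open>'c fm\<close> that use
  connectives outside \<open>C\<close> or with the wrong number of arguments are excluded.\<close>

inductive_set formulas :: "'c signature \<Rightarrow> 'c fm set" for C :: "'c signature" where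
  Var: "Var n \<in> formulas C"
| App: "\<lbrakk>c \<in> C k; length ts = k; \<And>t. t \<in> set ts \<Longrightarrow> t \<in> formulas C\<rbrakk> \<Longrightarrow> App c ts \<in> formulas C"

record ('c, 'a) matrix =
  universe :: "'a set"
  interp :: "'c \<Rightarrow> 'a list \<Rightarrow> 'a"
  designated :: "'a set"

text \<open>The function \<open>interp M c\<close> matters only on argument lists over the universe whose length is the
  arity of \<open>c\<close>.\<close>

definition is_matrix :: "'c signature \<Rightarrow> ('c, 'a) matrix \<Rightarrow> bool" where
  "is_matrix C M \<longleftrightarrow>
     (\<forall>k. \<forall>c \<in> C k. \<forall>xs. length xs = k \<and> set xs \<subseteq> universe M \<longrightarrow> interp M c xs \<in> universe M) \<and>
     designated M \<subseteq> universe M"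

definition valuation :: "'c signature \<Rightarrow> ('c, 'a) matrix \<Rightarrow> ('c fm \<Rightarrow> 'a) \<Rightarrow> bool" where
  "valuation C M v \<longleftrightarrow>
     v \<in> formulas C \<rightarrow> universe M \<and>
     (\<forall>k. \<forall>c \<in> C k. \<forall>ts. length ts = k \<and> set ts \<subseteq> formulas C \<longrightarrow>
        v (App c ts) = interp M c (map v ts))"

definition matrix_conseq :: "'c signature \<Rightarrow> ('c, 'a) matrix \<Rightarrow> 'c fm set \<Rightarrow> 'c fm \<Rightarrow> bool" where
  "matrix_conseq C M \<Gamma> \<phi> \<longleftrightarrow>
     (\<forall>v. valuation C M v \<longrightarrow> v ` \<Gamma> \<subseteq> designated M \<longrightarrow> v \<phi> \<in> designated M)"

text \<open>In a logic \<open>(C, conseq)\<close> the relation is only meaningful on subsets and elements of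
  \<open>formulas C\<close>.\<close>

type_synonym 'c logic = "'c signature \<times> ('c fm set \<Rightarrow> 'c fm \<Rightarrow> bool)"

definition matrix_logic :: "'c signature \<Rightarrow> ('c, 'a) matrix \<Rightarrow> 'c logic" where
  "matrix_logic C M = (C, matrix_conseq C M)"

definition trivial_logic :: "'c logic \<Rightarrow> bool" where
  "trivial_logic L \<longleftrightarrow> (\<forall>\<Gamma> \<phi>. \<Gamma> \<union> {\<phi>} \<subseteq> formulas (fst L) \<longrightarrow> snd L \<Gamma> \<phi>)"

text \<open>Disjoint unions are taken in sum types, so \<open>L(C\<^sub>1)\<close> is regarded as a part of the language over
  \<open>sig_sum C\<^sub>1 C\<^sub>2\<close> through \<open>map_fm Inl\<close>, and \<open>L(C\<^sub>2)\<close> through \<open>map_fm Inr\<close>.\<close>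

definition sig_sum :: "'c signature \<Rightarrow> 'd signature \<Rightarrow> ('c + 'd) signature" where
  "sig_sum C1 C2 = (\<lambda>k. C1 k <+> C2 k)"

definition star_lambda :: "('a \<Rightarrow> 'b) \<Rightarrow> 'a + 'b \<Rightarrow> 'b" where
  "star_lambda l x = (case x of Inl a \<Rightarrow> l a | Inr b \<Rightarrow> b)"

definition star_mu :: "('b \<Rightarrow> 'a) \<Rightarrow> 'a + 'b \<Rightarrow> 'a" where
  "star_mu m x = (case x of Inl a \<Rightarrow> a | Inr b \<Rightarrow> m b)"

definition fibred_matrix ::
  "('c, 'a) matrix \<Rightarrow> ('d, 'b) matrix \<Rightarrow> ('a \<Rightarrow> 'b) \<Rightarrow> ('b \<Rightarrow> 'a) \<Rightarrow> ('c + 'd, 'a + 'b) matrix" where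
  "fibred_matrix M1 M2 l m =
     \<lparr> universe = universe M1 <+> universe M2,
       interp = (\<lambda>c xs. case c of
           Inl c1 \<Rightarrow> Inl (interp M1 c1 (map (star_mu m) xs))
         | Inr c2 \<Rightarrow> Inr (interp M2 c2 (map (star_lambda l) xs))),
       designated = designated M1 <+> designated M2 \<rparr>"

definition fibring ::
  "'c signature \<Rightarrow> ('c, 'a) matrix \<Rightarrow> 'd signature \<Rightarrow> ('d, 'b) matrix
     \<Rightarrow> ('a \<Rightarrow> 'b) \<Rightarrow> ('b \<Rightarrow> 'a) \<Rightarrow> ('c + 'd) logic" where
  "fibring C1 M1 C2 M2 l m = matrix_logic (sig_sum C1 C2) (fibred_matrix M1 M2 l m)"

text \<open>The map \<open>e\<close> is the inclusion of the connectives of \<open>L\<close> into those of \<open>L'\<close>.\<close>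

definition weak_conservative_extension :: "('c \<Rightarrow> 'd) \<Rightarrow> 'c logic \<Rightarrow> 'd logic \<Rightarrow> bool" where
  "weak_conservative_extension e L L' \<longleftrightarrow>
     (\<forall>\<phi> \<in> formulas (fst L). snd L {} \<phi> \<longleftrightarrow> snd L' {} (map_fm e \<phi>))"

lemma is_signature_sig_sum:
  "is_signature C1 \<Longrightarrow> is_signature C2 \<Longrightarrow> is_signature (sig_sum C1 C2)"
  unfolding is_signature_def sig_sum_def disjoint_family_on_def by blast

lemma is_matrix_fibred_matrix:
  assumes "is_matrix C1 M1" "is_matrix C2 M2"
    and "l \<in> universe M1 \<rightarrow> universe M2" "m \<in> universe M2 \<rightarrow> universe M1"
  shows "is_matrix (sig_sum C1 C2) (fibred_matrix M1 M2 l m)"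
proof -
  have "star_mu m ` set xs \<subseteq> universe M1" "star_lambda l ` set xs \<subseteq> universe M2"
    if "set xs \<subseteq> universe M1 <+> universe M2" for xs
    using that assms(3,4) by (fastforce simp: star_mu_def star_lambda_def)+
  moreover have "designated M1 <+> designated M2 \<subseteq> universe M1 <+> universe M2"
    using assms(1,2) by (auto simp: is_matrix_def)
  ultimately show ?thesis
    using assms(1,2) by (auto simp: is_matrix_def sig_sum_def fibred_matrix_def)
qed

end

theory Submission
  imports Defs
begin

text \<open>Composing a valuation of the fibred matrix with \<open>star_mu\<close> gives a valuation of \<open>M1\<close>, and the two
  agree on every formula of \<open>L(C1)\<close> that starts with a connective. Conversely, the
  values of a valuation of \<open>M1\<close> on the variables, read in the disjoint union, generate
  a valuation of the fibred matrix that extends it. Only variables remain: a valuation of the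
  fibred matrix may send them into the other component, but non-triviality yields an undesignated
  value, so that no variable is valid in \<open>M1\<close>. The same argument applies to \<open>M2\<close>.\<close>

text \<open>The homomorphism generated by an assignment \<open>f\<close> of the variables, by
  freeness of the formula algebra. It is defined on the whole type \<open>'c fm\<close>; only its
  values on \<open>formulas C\<close> matter.\<close>

primrec eval_fm :: "('c, 'a) matrix \<Rightarrow> (nat \<Rightarrow> 'a) \<Rightarrow> 'c fm \<Rightarrow> 'a" where
  "eval_fm M f (Var n) = f n"
| "eval_fm M f (App c ts) = interp M c (map (eval_fm M f) ts)"

lemma valuation_eval_fm:
  assumes M: "is_matrix C M" and f: "range f \<subseteq> universe M"
  shows "valuation C M (eval_fm M f)"
proof -
  have "eval_fm M f \<phi> \<in> universe M" if "\<phi> \<in> formulas C" for \<phi>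
    using that
  proof induction
    case (Var n)
    then show ?case using f by auto
  next
    case (App c k ts)
    then have "length (map (eval_fm M f) ts) = k" "set (map (eval_fm M f) ts) \<subseteq> universe M"
      by auto
    then show ?case using M App.hyps(1) unfolding is_matrix_def eval_fm.simps by blast
  qed
  then show ?thesis by (auto simp: valuation_def)
qed

lemma map_fm_in_formulas:
  assumes "\<phi> \<in> formulas C" and "\<And>c k. c \<in> C k \<Longrightarrow> e c \<in> C' k"
  shows "map_fm e \<phi> \<in> formulas C'"
  using assms(1) by induction (auto intro!: formulas.intros assms(2))

text \<open>A failing consequence comes with a valuation that sends its conclusion outside the
  designated set, and valuations stay in the universe on formulas.\<close>

lemma nontrivial_obtains_undesignated:
  assumes "\<not> trivial_logic (matrix_logic C M)"
  obtains a where "a \<in> universe M" "a \<notin> designated M"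
proof -
  obtain v \<phi> where "valuation C M v" "\<phi> \<in> formulas C" "v \<phi> \<notin> designated M"
    using assms by (auto simp: trivial_logic_def matrix_logic_def matrix_conseq_def)
  then show thesis using that[of "v \<phi>"] by (auto simp: valuation_def)
qed

text \<open>Treats both components at once: \<open>i\<close> is the injection of one universe into
  the disjoint union and \<open>r\<close> the star map that retracts onto it. By
  \<open>interp\<close>, operations of \<open>M'\<close> named by \<open>e\<close> retract their
  arguments, compute in \<open>M\<close> and inject the result.\<close>

lemma weak_conservative_extension_matrix:
  fixes M :: "('c, 'a) matrix" and M' :: "('d, 'b) matrix"
  assumes M: "is_matrix C M" and M': "is_matrix C' M'"
    and nontriv: "\<not> trivial_logic (matrix_logic C M)"
    and e: "\<And>c k. c \<in> C k \<Longrightarrow> e c \<in> C' k"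
    and i: "i \<in> universe M \<rightarrow> universe M'"
    and r: "r \<in> universe M' \<rightarrow> universe M"
    and ri: "\<And>a. r (i a) = a"
    and interp: "\<And>c xs. interp M' (e c) xs = i (interp M c (map r xs))"
    and des: "\<And>a. i a \<in> designated M' \<longleftrightarrow> a \<in> designated M"
  shows "weak_conservative_extension e (matrix_logic C M) (matrix_logic C' M')"
proof -
  have "matrix_conseq C' M' {} (map_fm e \<phi>)"
    if \<phi>: "\<phi> \<in> formulas C" and valid: "matrix_conseq C M {} \<phi>" for \<phi>
  proof -
    have "v (map_fm e \<phi>) \<in> designated M'" if v: "valuation C' M' v" for v
    proof -
      define w where "w = r \<circ> v \<circ> map_fm e"
      \<comment> \<open>Wherever \<open>v\<close> sends the variables, a compound formula gets a
        value in the range of \<open>i\<close>, since the operation reads its arguments only through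
        \<open>r\<close>.\<close>
      have app: "v (map_fm e (App c ts)) = i (interp M c (map w ts))"
        if "c \<in> C k" "length ts = k" "set ts \<subseteq> formulas C" for c k ts
      proof -
        have "set (map (map_fm e) ts) \<subseteq> formulas C'"
          using that(3) map_fm_in_formulas[of _ C e C'] e by auto
        moreover have "length (map (map_fm e) ts) = k" using that(2) by simp
        ultimately have "v (App (e c) (map (map_fm e) ts)) = interp M' (e c) (map v (map (map_fm e) ts))"
          using v e[OF that(1)] unfolding valuation_def by blast
        then show ?thesis by (simp add: interp w_def comp_assoc)
      qed
      have "valuation C M w"
        unfolding valuation_def
      proof (intro conjI allI ballI impI)
        have "map_fm e t \<in> formulas C'" if "t \<in> formulas C" for t
          using map_fm_in_formulas that e by blast
        then show "w \<in> formulas C \<rightarrow> universe M"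
          using v r by (auto simp: valuation_def w_def Pi_iff)
      next
        fix c k ts
        assume "c \<in> C k" "length ts = k \<and> set ts \<subseteq> formulas C"
        then have "r (v (map_fm e (App c ts))) = interp M c (map w ts)"
          using app ri by simp
        then show "w (App c ts) = interp M c (map w ts)" by (simp add: w_def)
      qed
      then have w\<phi>: "w \<phi> \<in> designated M" and w: "valuation C M w"
        using valid by (auto simp: matrix_conseq_def)
      show ?thesis
        using \<phi>
      proof cases
        \<comment> \<open>Here \<open>v\<close> may take a value outside the range of
          \<open>i\<close>, so \<open>w\<phi>\<close> says nothing about it. Instead the case is
          contradictory: the valuation generated by a constant undesignated assignment refutes the
          variable.\<close>
        case (Var n)
        obtain a where a: "a \<in> universe M" "a \<notin> designated M"
          using nontrivial_obtains_undesignated[OF nontriv] .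
        have "valuation C M (eval_fm M (\<lambda>_. a))"
          using a(1) by (intro valuation_eval_fm[OF M]) auto
        then have "eval_fm M (\<lambda>_. a) \<phi> \<in> designated M"
          using valid by (auto simp: matrix_conseq_def)
        then show ?thesis using a(2) Var by simp
      next
        case (App c k ts)
        then have ts: "set ts \<subseteq> formulas C" by auto
        have "v (map_fm e \<phi>) = i (interp M c (map w ts))"
          using app[OF App(2,3) ts] App(1) by simp
        also have "interp M c (map w ts) = w \<phi>"
          using w App(1-3) ts unfolding valuation_def by metis
        finally show ?thesis using w\<phi> des by simp
      qed
    qed
    then show ?thesis by (simp add: matrix_conseq_def)
  qed
  moreover have "matrix_conseq C M {} \<phi>"
    if \<phi>: "\<phi> \<in> formulas C" and valid: "matrix_conseq C' M' {} (map_fm e \<phi>)" for \<phi>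
  proof -
    have "w \<phi> \<in> designated M" if w: "valuation C M w" for w
    proof -
      let ?v = "eval_fm M' (\<lambda>n. i (w (Var n)))"
      have "w (Var n) \<in> universe M" for n
        using w by (auto simp: valuation_def intro: formulas.Var)
      then have "valuation C' M' ?v"
        using i by (intro valuation_eval_fm[OF M']) auto
      then have "?v (map_fm e \<phi>) \<in> designated M'"
        using valid by (simp add: matrix_conseq_def)
      moreover have "?v (map_fm e \<phi>) = i (w \<phi>)"
        using \<phi>
      proof induction
        case (Var n)
        then show ?case by simp
      next
        case (App c k ts)
        then have ts: "set ts \<subseteq> formulas C" by auto
        \<comment> \<open>By induction \<open>?v\<close> agrees with \<open>i\<close> after
          \<open>w\<close> on the arguments, and \<open>r\<close> cancels \<open>i\<close>.\<close>
        have "map (r \<circ> ?v \<circ> map_fm e) ts = map w ts"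
          using App.IH ri by simp
        moreover have "w (App c ts) = interp M c (map w ts)"
          using w App.hyps(1,2) ts unfolding valuation_def by blast
        ultimately show ?case by (simp add: interp comp_assoc cong: map_cong)
      qed
      ultimately show ?thesis using des by simp
    qed
    then show ?thesis by (simp add: matrix_conseq_def)
  qed
  ultimately show ?thesis
    by (auto simp: weak_conservative_extension_def matrix_logic_def)
qed

theorem proposition3p5:
  fixes C1 :: "'c signature" and C2 :: "'d signature"
    and M1 :: "('c, 'a) matrix" and M2 :: "('d, 'b) matrix"
    and l :: "'a \<Rightarrow> 'b" and m :: "'b \<Rightarrow> 'a"
  assumes "is_signature C1" and "is_signature C2"
    and "is_matrix C1 M1" and "is_matrix C2 M2"
    and "\<not> trivial_logic (matrix_logic C1 M1)"
    and "\<not> trivial_logic (matrix_logic C2 M2)"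
    and "l \<in> universe M1 \<rightarrow> universe M2"
    and "m \<in> universe M2 \<rightarrow> universe M1"
  shows "weak_conservative_extension Inl (matrix_logic C1 M1) (fibring C1 M1 C2 M2 l m)
       \<and> weak_conservative_extension Inr (matrix_logic C2 M2) (fibring C1 M1 C2 M2 l m)"
proof -
  let ?C = "sig_sum C1 C2" and ?M = "fibred_matrix M1 M2 l m"
  have M: "is_matrix ?C ?M"
    using is_matrix_fibred_matrix assms(3,4,7,8) by blast
  \<comment> \<open>The retraction is the star map that the fibred matrix applies to arguments of
    connectives from \<open>C1\<close>; the assumption on \<open>m\<close> keeps its values in the
    universe of \<open>M1\<close>.\<close>
  have "weak_conservative_extension Inl (matrix_logic C1 M1) (matrix_logic ?C ?M)"
    using assms(8)
    by (intro weak_conservative_extension_matrix[where i = Inl and r = "star_mu m", OF assms(3) M assms(5)])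
      (auto simp: sig_sum_def fibred_matrix_def star_mu_def)
  moreover have "weak_conservative_extension Inr (matrix_logic C2 M2) (matrix_logic ?C ?M)"
    using assms(7)
    by (intro weak_conservative_extension_matrix[where i = Inr and r = "star_lambda l", OF assms(4) M assms(6)])
      (auto simp: sig_sum_def fibred_matrix_def star_lambda_def)
  ultimately show ?thesis by (simp add: fibring_def)
qed

end
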